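(* Let $f\in L^2([0,1))$ and let $(\gamma_n)_{n\in\mathbb{N}}\subset(0,\infty)$ be a (possibly random) sequence such that $\gamma_n\to0$ and $\gamma_n n/\beta_n\to\infty$ $\mathbb{P}$-a.s. Then for any estimators $\hat f_n\in\iota^n(\operatorname{argmin} H_{\gamma_n}(\cdot,Y_n))$, $$\hat f_n\xrightarrow[n\to\infty]{} f\quad\text{in } L^2([0,1)),\qquad\mathbb{P}\text{-a.s.}$$
   Context: Regression model: for $n\in\mathbb{N}$ and $1\le i\le n$, $Y_{i,n}=\bar f_{i,n}+\xi_{i,n}$, where $\bar f_{i,n}=n\int_{(i-1)/n}^{i/n}f(u)\,du$ and $(\xi_{i,n})_{1\le i\le n,\,n\in\mathbb{N}}$ is a triangular array of zero-mean real random variables on a probability space with measure $\mathbb{P}$. Write $Y_n=(Y_{1,n},\dots,Y_{n,n})$. Standing assumption on the noise (Condition (A)): for each $n$ the variables $(\xi_{i,n})_{1\le i\le n}$ are independent, and $(\beta_n)_{n\in\mathbb{N}}$ is a fixed (deterministic) sequence of positive numbers with $\beta_n/n\to0$ such that $\mathbb{P}$-a.s., for all but finitely many $n$, $\max_{1\le i\le j\le n}\frac{(\xi_{i,n}+\cdots+\xi_{j,n})^2}{j-i+1}\le\beta_n$. For $u\in\mathbb{R}^n$ let $J(u)=\{i:1\le i\le n-1,\ u_i\ne u_{i+1}\}$ and $H_\gamma(u,Y_n)=\gamma\,\#J(u)+\frac1n\sum_{i=1}^n(u_i-Y_{i,n})^2$. $\operatorname{argmin}F$ denotes the whole set of minimizers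 of $F$. The map $\iota^n:\mathbb{R}^n\to L^2([0,1))$ is $\iota^n(u)=\sum_{i=1}^n u_i\mathbf{1}_{[(i-1)/n,i/n)}$. *)

theory Defs
  imports "HOL-Probability.Probability"
begin

text \<open>
  Elements of \<open>L\<^sup>2([0,1))\<close> are represented by functions on the reals of which only the restriction
  to \<open>[0,1)\<close> matters; almost-everywhere equal functions are not identified.
\<close>

definition L2 :: "(real \<Rightarrow> real) set" where
  "L2 = {g. g \<in> borel_measurable (lebesgue_on {0..<1}) \<and>
            integrable (lebesgue_on {0..<1}) (\<lambda>x. (g x)\<^sup>2)}"

definition L2_norm :: "(real \<Rightarrow> real) \<Rightarrow> real" where
  "L2_norm g = sqrt (LINT x|lebesgue_on {0..<1}. (g x)\<^sup>2)"

text \<open>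
  All sequences are indexed by \<open>n \<ge> 1\<close>, so the term with index 0 is ignored. Membership
  in \<open>L2\<close> is demanded explicitly because the Bochner integral of a non-integrable
  function is 0.
\<close>

definition tendsto_L2 :: "(nat \<Rightarrow> real \<Rightarrow> real) \<Rightarrow> (real \<Rightarrow> real) \<Rightarrow> bool" where
  "tendsto_L2 F g \<longleftrightarrow> (\<forall>n\<ge>1. F n \<in> L2) \<and> g \<in> L2 \<and>
     (\<lambda>n. L2_norm (\<lambda>x. F n x - g x)) \<longlonglongrightarrow> 0"

text \<open>Vectors in \<open>\<real>\<^sup>n\<close> are the functions on \<open>{1..n}\<close>, extended by \<open>undefined\<close>.\<close>

definition Rn :: "nat \<Rightarrow> (nat \<Rightarrow> real) set" where
  "Rn n = {1..n} \<rightarrow>\<^sub>E UNIV"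

definition jumps :: "nat \<Rightarrow> (nat \<Rightarrow> real) \<Rightarrow> nat set" where
  "jumps n u = {i \<in> {1..n - 1}. u i \<noteq> u (i + 1)}"

definition H :: "nat \<Rightarrow> real \<Rightarrow> (nat \<Rightarrow> real) \<Rightarrow> (nat \<Rightarrow> real) \<Rightarrow> real" where
  "H n \<gamma> u y = \<gamma> * real (card (jumps n u)) + 1 / real n * (\<Sum>i=1..n. (u i - y i)\<^sup>2)"

definition argmin_H :: "nat \<Rightarrow> real \<Rightarrow> (nat \<Rightarrow> real) \<Rightarrow> (nat \<Rightarrow> real) set" where
  "argmin_H n \<gamma> y = {u. is_arg_min (\<lambda>u. H n \<gamma> u y) (\<lambda>u. u \<in> Rn n) u}"

definition \<iota> :: "nat \<Rightarrow> (nat \<Rightarrow> real) \<Rightarrow> real \<Rightarrow> real" where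
  "\<iota> n u = (\<lambda>x. \<Sum>i=1..n. u i * indicator {(real i - 1) / real n ..< real i / real n} x)"

definition fbar :: "(real \<Rightarrow> real) \<Rightarrow> nat \<Rightarrow> nat \<Rightarrow> real" where
  "fbar f n i = real n * (LINT u:{(real i - 1) / real n ..< real i / real n}|lebesgue. f u)"

definition Y :: "(real \<Rightarrow> real) \<Rightarrow> (nat \<Rightarrow> nat \<Rightarrow> 'a \<Rightarrow> real) \<Rightarrow> nat \<Rightarrow> 'a \<Rightarrow> nat \<Rightarrow> real" where
  "Y f \<xi> n \<omega> = (\<lambda>i\<in>{1..n}. fbar f n i + \<xi> n i \<omega>)"

text \<open>\<open>\<xi> n i\<close> stands for \<open>\<xi>\<^bsub>i,n\<^esub>\<close>; only the entries with \<open>1 \<le> i \<le> n\<close> are used.\<close>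

definition zero_mean_array :: "'a measure \<Rightarrow> (nat \<Rightarrow> nat \<Rightarrow> 'a \<Rightarrow> real) \<Rightarrow> bool" where
  "zero_mean_array M \<xi> \<longleftrightarrow>
     (\<forall>n\<ge>1. \<forall>i\<in>{1..n}. integrable M (\<xi> n i) \<and> (LINT \<omega>|M. \<xi> n i \<omega>) = 0)"

definition condition_A ::
    "'a measure \<Rightarrow> (nat \<Rightarrow> nat \<Rightarrow> 'a \<Rightarrow> real) \<Rightarrow> (nat \<Rightarrow> real) \<Rightarrow> bool" where
  "condition_A M \<xi> \<beta> \<longleftrightarrow>
     (\<forall>n\<ge>1. prob_space.indep_vars M (\<lambda>_. borel) (\<xi> n) {1..n}) \<and>
     (\<forall>n\<ge>1. \<beta> n > 0) \<and>
     (\<lambda>n. \<beta> n / real n) \<longlonglongrightarrow> 0 \<and>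
     (AE \<omega> in M. \<forall>\<^sub>F n in sequentially.
        Max {(\<Sum>k=i..j. \<xi> n k \<omega>)\<^sup>2 / real (j - i + 1) | i j. 1 \<le> i \<and> i \<le> j \<and> j \<le> n} \<le> \<beta> n)"

end

theory Submission
  imports Defs
begin

text \<open>
  Comparing a minimizer \<open>u\<close> with any competitor \<open>v\<close> leaves the noise term
  \<open>2/n \<langle>u - v, \<xi>\<rangle>\<close>. On each constant piece of \<open>u - v\<close>, AM-GM and Condition (A) bound the
  noise term by a quarter of the squared norm of the piece plus \<open>4 \<beta>\<^sub>n\<close>. Once \<open>4 \<beta>\<^sub>n \<le> \<gamma>\<^sub>n n\<close>,
  the penalty of \<open>u\<close> absorbs the contribution of its own jumps, so that
  \<open>|u - fbar|\<^sup>2/n \<le> 2 \<gamma>\<^sub>n (2 #J(v) + 1) + 3 |v - fbar|\<^sup>2/n\<close>.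
  Since \<open>\<iota>\<^sup>n fbar\<close> is the orthogonal projection of \<open>f\<close> onto the range of \<open>\<iota>\<^sup>n\<close>, the same bound holds
  with \<open>\<parallel>\<iota>\<^sup>n u - f\<parallel>\<^sup>2\<close> and \<open>\<parallel>\<iota>\<^sup>n v - f\<parallel>\<^sup>2\<close>, and \<open>v\<close> can be chosen with a number of jumps independent
  of \<open>n\<close> and \<open>\<iota>\<^sup>n v\<close> close to \<open>f\<close>.
\<close>

section \<open>Noise bound and comparison of a minimizer with a competitor\<close>

lemma twice_sum_mult_le_jumps:
  fixes w \<xi> :: "nat \<Rightarrow> real"
  assumes noise: "\<And>i j. 1 \<le> i \<Longrightarrow> i \<le> j \<Longrightarrow> j \<le> n \<Longrightarrow>
      (\<Sum>k=i..j. \<xi> k)\<^sup>2 \<le> b * real (j - i + 1)"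
    and "0 \<le> b" "m \<le> n"
  shows "2 * (\<Sum>i=1..m. w i * \<xi> i) \<le> (\<Sum>i=1..m. (w i)\<^sup>2) / 4 + 4 * b * (real (card (jumps m w)) + 1)"
  using \<open>m \<le> n\<close>
\<comment> \<open>Strong induction on the length \<open>m\<close> with \<open>n\<close> fixed: the
  stretch after the last jump \<open>p\<close> is split off as one constant piece, and the induction
  hypothesis is applied to the first \<open>p\<close> indices. Every piece costs
  \<open>4 * b\<close>, and there is one more piece than there are jumps.\<close>
proof (induction m rule: less_induct)
  case (less m)
  have piece: "2 * (\<Sum>i=Suc p..m. w i * \<xi> i) \<le> (\<Sum>i=Suc p..m. (w i)\<^sup>2) / 4 + 4 * b"
    if "p < m" and const: "\<And>i. i \<in> {Suc p..m} \<Longrightarrow> w i = w m" for p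
  proof -
    define S L where "S = (\<Sum>i=Suc p..m. \<xi> i)" and "L = real (m - p)"
    have "L > 0" using \<open>p < m\<close> by (simp add: L_def)
    have "S\<^sup>2 \<le> b * L"
      using noise[of "Suc p" m] less.prems \<open>p < m\<close> by (simp add: S_def L_def Suc_diff_Suc)
    have "0 \<le> (w m * L - 4 * S)\<^sup>2" by simp \<comment> \<open>AM-GM for \<open>w m * L / 2\<close> and \<open>2 * S\<close>\<close>
    \<comment> \<open>The factor \<open>L\<close> stays on both sides until
      \<open>S\<^sup>2 \<le> b * L\<close> has been inserted; then it cancels.\<close>
    then have "L * (2 * (w m * S)) \<le> L * ((w m)\<^sup>2 * L / 4) + 4 * S\<^sup>2"
      by (simp add: power2_eq_square algebra_simps)
    also have "\<dots> \<le> L * ((w m)\<^sup>2 * L / 4) + 4 * (b * L)"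
      using \<open>S\<^sup>2 \<le> b * L\<close> by simp
    also have "\<dots> = L * ((w m)\<^sup>2 * L / 4 + 4 * b)"
      by (simp add: ring_distribs)
    finally have "2 * (w m * S) \<le> (w m)\<^sup>2 * L / 4 + 4 * b"
      by (rule mult_left_le_imp_le) fact
    moreover have "(\<Sum>i=Suc p..m. w i * \<xi> i) = w m * S"
      unfolding S_def sum_distrib_left by (intro sum.cong refl) (drule const, simp)
    moreover have "(\<Sum>i=Suc p..m. (w i)\<^sup>2) = (\<Sum>i=Suc p..m. (w m)\<^sup>2)"
      by (intro sum.cong refl) (drule const, simp)
    then have "(\<Sum>i=Suc p..m. (w i)\<^sup>2) = (w m)\<^sup>2 * L"
      by (simp add: L_def)
    ultimately show ?thesis by simp
  qed
  \<comment> \<open>Downward induction from \<open>m\<close>: beyond \<open>p\<close> there is no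
    jump, so each value equals its successor.\<close>
  have const: "w i = w m" if "p < i" "i \<le> m" "\<And>j. j \<in> jumps m w \<Longrightarrow> j \<le> p" for i p
    using \<open>i \<le> m\<close> \<open>p < i\<close>
  proof (induction i rule: inc_induct)
    case (step i)
    then have "i \<notin> jumps m w" using that(3)[of i] by auto
    then have "w i = w (Suc i)" using step by (auto simp: jumps_def)
    then show ?case using step by simp
  qed simp
  show ?case
  proof (cases "jumps m w = {}")
    case True
    show ?thesis
    proof (cases "m = 0")
      case True then show ?thesis using \<open>0 \<le> b\<close> by simp
    next
      case False
      then have "2 * (\<Sum>i=Suc 0..m. w i * \<xi> i) \<le> (\<Sum>i=Suc 0..m. (w i)\<^sup>2) / 4 + 4 * b"
        using \<open>jumps m w = {}\<close> by (intro piece const[of 0]) auto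
      then show ?thesis using \<open>jumps m w = {}\<close> by simp
    qed
  next
    case False
    have fin: "finite (jumps k w)" for k by (simp add: jumps_def)
    define p where "p = Max (jumps m w)"
    have p: "p \<in> jumps m w" "\<And>j. j \<in> jumps m w \<Longrightarrow> j \<le> p"
      using False fin by (auto simp: p_def)
    then have "1 \<le> p" "p < m" "w p \<noteq> w (p + 1)" by (auto simp: jumps_def)
    \<comment> \<open>Only indices up to \<open>p - 1\<close> are tested in
      \<open>jumps p w\<close>, so shortening from \<open>m\<close> to \<open>p\<close> loses
      exactly the jump \<open>p\<close>.\<close>
    have "jumps m w = insert p (jumps p w)"
    proof
      show "jumps m w \<subseteq> insert p (jumps p w)"
      proof
        fix j assume j: "j \<in> jumps m w"
        then have "j \<le> p" by (rule p(2))
        then have "j = p \<or> j \<le> p - 1" by linarith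
        then show "j \<in> insert p (jumps p w)" using j by (auto simp: jumps_def)
      qed
      show "insert p (jumps p w) \<subseteq> jumps m w"
        using p(1) by (auto simp: jumps_def)
    qed
    moreover have "p \<notin> jumps p w" using \<open>1 \<le> p\<close> by (auto simp: jumps_def)
    ultimately have card: "card (jumps m w) = card (jumps p w) + 1" using fin by simp
    have split: "(\<Sum>i=1..m. g i) = (\<Sum>i=1..p. g i) + (\<Sum>i=Suc p..m. g i)" for g :: "nat \<Rightarrow> real"
      using sum.ub_add_nat[of 1 p g "m - p"] \<open>p < m\<close> by simp
    have "2 * (\<Sum>i=1..p. w i * \<xi> i) \<le> (\<Sum>i=1..p. (w i)\<^sup>2) / 4 + 4 * b * (real (card (jumps p w)) + 1)"
      using less.IH[of p] less.prems \<open>p < m\<close> by simp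
    moreover have "2 * (\<Sum>i=Suc p..m. w i * \<xi> i) \<le> (\<Sum>i=Suc p..m. (w i)\<^sup>2) / 4 + 4 * b"
      using p(2) \<open>p < m\<close> by (intro piece const[of p]) auto
    ultimately show ?thesis
      unfolding split card by (simp add: algebra_simps add_divide_distrib)
  qed
qed

lemma jumps_diff_subset: "jumps n (\<lambda>i. u i - v i) \<subseteq> jumps n u \<union> jumps n v"
  by (auto simp: jumps_def)

text \<open>Write \<open>U\<close>, \<open>V\<close> for the two sums of squared errors and J for
  the number of jumps. Minimality gives \<open>U\<close> + g n J(u) \<le> \<open>V\<close> + g n
  J(v) + 2 \<open>X\<close>, and the noise bound gives 2 \<open>X\<close> \<le> (\<open>U\<close> +
  \<open>V\<close>)/2 + g n (J(u) + J(v) + 1). The terms g n J(u) cancel, and doubling what remains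
  produces the factors 2 and 3.\<close>

lemma minimizer_error_le:
  fixes a \<xi> :: "nat \<Rightarrow> real"
  assumes noise: "\<And>i j. 1 \<le> i \<Longrightarrow> i \<le> j \<Longrightarrow> j \<le> n \<Longrightarrow>
      (\<Sum>k=i..j. \<xi> k)\<^sup>2 \<le> b * real (j - i + 1)"
    and "0 \<le> b" "1 \<le> n" and small: "4 * b \<le> g * real n"
    and y: "\<And>i. i \<in> {1..n} \<Longrightarrow> y i = a i + \<xi> i"
    and u: "u \<in> argmin_H n g y"
  shows "(\<Sum>i=1..n. (u i - a i)\<^sup>2) / real n
    \<le> 2 * g * (2 * real (card (jumps n v)) + 1) + 3 * ((\<Sum>i=1..n. (v i - a i)\<^sup>2) / real n)"
proof -
  \<comment> \<open>The competitor \<open>v\<close> is arbitrary outside \<open>{1..n}\<close>,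
    whereas minimality compares only elements of \<open>Rn n\<close>.\<close>
  define v' where "v' = restrict v {1..n}"
  have jv: "jumps n v' = jumps n v" by (auto simp: jumps_def v'_def)
  have "v' \<in> Rn n" by (simp add: Rn_def v'_def)
  then have "H n g u y \<le> H n g v' y"
    using u by (auto simp: argmin_H_def is_arg_min_def not_less)
  also have "H n g v' y = H n g v y"
    unfolding H_def jv by (simp add: v'_def)
  finally have "real n * H n g u y \<le> real n * H n g v y"
    by (simp add: mult_left_mono)
  then have min: "g * real n * card (jumps n u) + (\<Sum>i=1..n. (u i - y i)\<^sup>2)
     \<le> g * real n * card (jumps n v) + (\<Sum>i=1..n. (v i - y i)\<^sup>2)"
    using \<open>1 \<le> n\<close> by (simp add: H_def algebra_simps)
  define U V X where "U = (\<Sum>i=1..n. (u i - a i)\<^sup>2)" and "V = (\<Sum>i=1..n. (v i - a i)\<^sup>2)"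
    and "X = (\<Sum>i=1..n. (u i - v i) * \<xi> i)"
  \<comment> \<open>The squares of the noise cancel, leaving only the cross term.\<close>
  have "(\<Sum>i=1..n. (u i - y i)\<^sup>2) - (\<Sum>i=1..n. (v i - y i)\<^sup>2) = U - V - 2 * X"
    unfolding U_def V_def X_def sum_distrib_left sum_subtractf[symmetric]
    by (rule sum.cong) (auto simp: y power2_eq_square algebra_simps)
  with min have 1: "g * real n * card (jumps n u) + U \<le> g * real n * card (jumps n v) + V + 2 * X"
    by simp
  have "card (jumps n (\<lambda>i. u i - v i)) \<le> card (jumps n u \<union> jumps n v)"
    by (intro card_mono jumps_diff_subset) (simp add: jumps_def)
  also have "\<dots> \<le> card (jumps n u) + card (jumps n v)" by (rule card_Un_le)
  finally have J: "real (card (jumps n (\<lambda>i. u i - v i))) \<le> card (jumps n u) + card (jumps n v)"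
    by linarith
  have X: "2 * X \<le> (\<Sum>i=1..n. (u i - v i)\<^sup>2) / 4 + 4 * b * (real (card (jumps n (\<lambda>i. u i - v i))) + 1)"
    unfolding X_def using twice_sum_mult_le_jumps[OF noise \<open>0 \<le> b\<close> order.refl] by simp
  have UV: "(\<Sum>i=1..n. (u i - v i)\<^sup>2) \<le> 2 * U + 2 * V"
    unfolding U_def V_def sum_distrib_left sum.distrib[symmetric]
  proof (rule sum_mono)
    fix i
    have "0 \<le> ((u i - a i) + (v i - a i))\<^sup>2" by simp
    then show "(u i - v i)\<^sup>2 \<le> 2 * (u i - a i)\<^sup>2 + 2 * (v i - a i)\<^sup>2"
      by (simp add: power2_eq_square algebra_simps)
  qed
  \<comment> \<open>By \<open>small\<close>, the noise cost of a piece is at most the penalty of one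
    jump.\<close>
  have noise_cost: "4 * b * (real (card (jumps n (\<lambda>i. u i - v i))) + 1)
      \<le> g * real n * (real (card (jumps n u)) + real (card (jumps n v)) + 1)"
    using J small \<open>0 \<le> b\<close> by (intro mult_mono[OF small]) auto
  have "2 * X \<le> (2 * U + 2 * V) / 4 + g * real n * (real (card (jumps n u)) + real (card (jumps n v)) + 1)"
    by (rule order_trans[OF X add_mono[OF divide_right_mono[OF UV] noise_cost]]) simp
  with 1 have "U \<le> real n * (2 * g * (2 * real (card (jumps n v)) + 1)) + 3 * V"
    by (simp add: algebra_simps add_divide_distrib)
  then show ?thesis
    unfolding U_def[symmetric] V_def[symmetric] using \<open>1 \<le> n\<close> by (simp add: field_simps)
qed

section \<open>Square-integrable functions on the unit interval\<close>

lemma finite_measure_unit: "finite_measure (lebesgue_on {0..<1::real})"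
  by (auto intro!: finite_measure_lebesgue_on fmeasurableI)

lemma L2_norm_power2: "(L2_norm g)\<^sup>2 = (LINT x|lebesgue_on {0..<1}. (g x)\<^sup>2)"
  by (simp add: L2_norm_def)

lemma L2_bounded:
  assumes [measurable]: "g \<in> borel_measurable (lebesgue_on {0..<1})" and "\<And>x. \<bar>g x\<bar> \<le> B"
  shows "g \<in> L2"
proof -
  interpret finite_measure "lebesgue_on {0..<1::real}" by (rule finite_measure_unit)
  have "\<bar>(g x)\<^sup>2\<bar> \<le> B\<^sup>2" for x
    using power_mono[OF assms(2)[of x], of 2] by simp
  then have "integrable (lebesgue_on {0..<1}) (\<lambda>x. (g x)\<^sup>2)"
    by (intro integrable_const_bound[of _ "B\<^sup>2"]) auto
  then show ?thesis by (simp add: L2_def)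
qed

lemma L2_mult_integrable:
  assumes "g \<in> L2" "h \<in> L2"
  shows "integrable (lebesgue_on {0..<1}) (\<lambda>x. g x * h x)"
proof (rule Bochner_Integration.integrable_bound)
  show "integrable (lebesgue_on {0..<1}) (\<lambda>x. (g x)\<^sup>2 + (h x)\<^sup>2)"
    using assms by (auto simp: L2_def)
  show "(\<lambda>x. g x * h x) \<in> borel_measurable (lebesgue_on {0..<1})"
    using assms by (auto simp: L2_def)
  have "\<bar>g x * h x\<bar> \<le> (g x)\<^sup>2 + (h x)\<^sup>2" for x
  proof -
    have "2 * (\<bar>g x\<bar> * \<bar>h x\<bar>) \<le> (g x)\<^sup>2 + (h x)\<^sup>2"
      using sum_squares_bound[of "\<bar>g x\<bar>" "\<bar>h x\<bar>"] by (simp add: mult.assoc)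
    moreover have "0 \<le> \<bar>g x\<bar> * \<bar>h x\<bar>" by simp
    ultimately show ?thesis unfolding abs_mult by linarith
  qed
  then show "AE x in lebesgue_on {0..<1}. norm (g x * h x) \<le> norm ((g x)\<^sup>2 + (h x)\<^sup>2)"
    by (auto intro!: AE_I2)
qed

lemma L2_integrable: "g \<in> L2 \<Longrightarrow> integrable (lebesgue_on {0..<1}) g"
  using L2_mult_integrable[of g "\<lambda>_. 1"] L2_bounded[of "\<lambda>_. 1" 1] by simp

lemma L2_diff:
  assumes "g \<in> L2" "h \<in> L2"
  shows "(\<lambda>x. g x - h x) \<in> L2"
  using assms L2_mult_integrable[OF assms] unfolding L2_def
  by (auto simp: power2_diff mult.assoc)

text \<open>Integrates (s + t)^2 \<le> 2 s^2 + 2 t^2. Working with squared norms replaces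
  Minkowski's inequality at the price of the factor 2, which is why error budgets are later cut into
  quarters.\<close>

lemma L2_norm_power2_triangle:
  assumes "f \<in> L2" "g \<in> L2" "h \<in> L2"
  shows "(L2_norm (\<lambda>x. f x - h x))\<^sup>2
    \<le> 2 * (L2_norm (\<lambda>x. f x - g x))\<^sup>2 + 2 * (L2_norm (\<lambda>x. g x - h x))\<^sup>2"
proof -
  have int: "integrable (lebesgue_on {0..<1}) (\<lambda>x. (p x - q x)\<^sup>2)" if "p \<in> L2" "q \<in> L2" for p q
    using L2_diff[OF that] by (simp add: L2_def)
  have "(f x - h x)\<^sup>2 \<le> 2 * (f x - g x)\<^sup>2 + 2 * (g x - h x)\<^sup>2" for x
  proof -
    have "0 \<le> ((f x - g x) - (g x - h x))\<^sup>2" by simp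
    then show ?thesis by (simp add: power2_eq_square algebra_simps)
  qed
  then have "(LINT x|lebesgue_on {0..<1}. (f x - h x)\<^sup>2)
      \<le> (LINT x|lebesgue_on {0..<1}. 2 * (f x - g x)\<^sup>2 + 2 * (g x - h x)\<^sup>2)"
    using int assms by (intro integral_mono) auto
  then show ?thesis
    using int assms by (simp add: L2_norm_power2)
qed

section \<open>Step functions, cell averages and orthogonal projection\<close>

lemma nat_floor_mult_less:
  assumes "1 \<le> n" "x \<in> {0..<1::real}"
  shows "nat \<lfloor>real n * x\<rfloor> < n"
proof -
  have "real n * x < real n" using assms by auto
  then show ?thesis using assms by (simp add: nat_less_iff floor_less_iff)
qed

lemma mem_cell_iff:
  assumes "1 \<le> n" "1 \<le> i" "x \<in> {0..<1::real}"
  shows "x \<in> {(real i - 1) / real n..<real i / real n} \<longleftrightarrow> i = nat \<lfloor>real n * x\<rfloor> + 1"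
proof -
  have "x \<in> {(real i - 1) / real n..<real i / real n} \<longleftrightarrow> real i - 1 \<le> real n * x \<and> real n * x < real i"
    using assms by (auto simp: field_simps)
  also have "\<dots> \<longleftrightarrow> \<lfloor>real n * x\<rfloor> = int i - 1"
    by (auto simp: floor_eq_iff)
  also have "\<dots> \<longleftrightarrow> i = nat \<lfloor>real n * x\<rfloor> + 1"
    using assms by auto
  finally show ?thesis .
qed

lemma \<iota>_eq:
  assumes "1 \<le> n" "x \<in> {0..<1}"
  shows "\<iota> n u x = u (nat \<lfloor>real n * x\<rfloor> + 1)"
proof -
  have "\<iota> n u x = (\<Sum>i=1..n. if i = nat \<lfloor>real n * x\<rfloor> + 1 then u i else 0)"
    unfolding \<iota>_def
  proof (rule sum.cong)
    fix i assume "i \<in> {1..n}"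
    then show "u i * indicator {(real i - 1) / real n..<real i / real n} x
        = (if i = nat \<lfloor>real n * x\<rfloor> + 1 then u i else 0)"
      using mem_cell_iff[OF assms(1) _ assms(2), of i] by (simp add: indicator_def)
  qed simp
  also have "\<dots> = u (nat \<lfloor>real n * x\<rfloor> + 1)"
    using nat_floor_mult_less[OF assms] by (simp add: sum.delta)
  finally show ?thesis .
qed

lemma \<iota>_L2: "\<iota> n u \<in> L2"
proof (rule L2_bounded)
  show "\<iota> n u \<in> borel_measurable (lebesgue_on {0..<1})"
    unfolding \<iota>_def by (intro measurable_restrict_space1 measurable_completion) measurable
  fix x
  have "\<bar>\<iota> n u x\<bar> \<le> (\<Sum>i=1..n. \<bar>u i * indicator {(real i - 1) / real n..<real i / real n} x\<bar>)"
    unfolding \<iota>_def by (rule sum_abs)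
  also have "\<dots> \<le> (\<Sum>i=1..n. \<bar>u i\<bar>)"
    by (intro sum_mono) (simp add: indicator_def)
  finally show "\<bar>\<iota> n u x\<bar> \<le> (\<Sum>i=1..n. \<bar>u i\<bar>)" .
qed

text \<open>With the inner product on vectors scaled by 1/n, this says that \<open>fbar\<close> is
  the adjoint of \<open>\<iota> n\<close>. It is the source of the projection property.\<close>

lemma integral_\<iota>_mult:
  assumes "1 \<le> n" "h \<in> L2"
  shows "(LINT x|lebesgue_on {0..<1}. \<iota> n u x * h x) = (\<Sum>i=1..n. u i * fbar h n i) / real n"
proof -
  let ?c = "\<lambda>i. {(real i - 1) / real n..<real i / real n}"
  have cell: "(LINT x|lebesgue_on {0..<1}. indicator (?c i) x * h x) = fbar h n i / real n"
    if "i \<in> {1..n}" for i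
  proof -
    \<comment> \<open>In \<open>fbar\<close> the integral is taken with respect to Lebesgue measure
      on the whole line; it agrees with the one over \<open>lebesgue_on {0..<1}\<close> because the
      cell lies inside the unit interval.\<close>
    have "?c i \<subseteq> {0..<1}"
    proof
      fix x assume x: "x \<in> ?c i"
      have "0 \<le> (real i - 1) / real n" "real i / real n \<le> 1" using that by auto
      then show "x \<in> {0..<1}" using x unfolding atLeastLessThan_iff by linarith
    qed
    then have "indicator {0..<1} x * (indicator (?c i) x * h x) = indicator (?c i) x * h x" for x
      by (auto simp: indicator_def)
    then show ?thesis
      using assms(1)
      by (subst integral_restrict_space) (simp_all only: real_scaleR_def, simp_all add: fbar_def set_lebesgue_integral_def)
  qed
  have int: "integrable (lebesgue_on {0..<1}) (\<lambda>x. indicator (?c i) x * h x)" for i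
    by (intro L2_mult_integrable[OF _ assms(2)] L2_bounded[of _ 1] measurable_restrict_space1
        measurable_completion borel_measurable_indicator) (auto simp: indicator_def)
  have "(LINT x|lebesgue_on {0..<1}. \<iota> n u x * h x)
      = (LINT x|lebesgue_on {0..<1}. (\<Sum>i=1..n. u i * (indicator (?c i) x * h x)))"
    unfolding \<iota>_def sum_distrib_right mult.assoc ..
  also have "\<dots> = (\<Sum>i=1..n. u i * (LINT x|lebesgue_on {0..<1}. indicator (?c i) x * h x))"
    using int by (subst Bochner_Integration.integral_sum) auto
  also have "\<dots> = (\<Sum>i=1..n. u i * (fbar h n i / real n))"
    using cell by (intro sum.cong) auto
  finally show ?thesis by (simp add: sum_divide_distrib)
qed

lemma fbar_1:
  assumes "1 \<le> n"
  shows "fbar (\<lambda>_. 1) n i = 1"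
  using assms by (simp add: fbar_def set_lebesgue_integral_def diff_divide_distrib)

text \<open>Pythagoras for the projection of \<open>f\<close> onto the step functions. Through it,
  bounds on vectors become bounds in L2: the residual is the same for every
  \<open>u\<close>.\<close>

lemma L2_norm_\<iota>_diff:
  assumes "1 \<le> n" "f \<in> L2"
  shows "(L2_norm (\<lambda>x. \<iota> n u x - f x))\<^sup>2
    = (\<Sum>i=1..n. (u i - fbar f n i)\<^sup>2) / real n + (L2_norm (\<lambda>x. \<iota> n (fbar f n) x - f x))\<^sup>2"
proof -
  \<comment> \<open>Used for \<open>w = u\<close> and for \<open>w = fbar f n\<close>; the norm of
    \<open>f\<close> then drops out of the identity.\<close>
  have expand: "(L2_norm (\<lambda>x. \<iota> n w x - f x))\<^sup>2
      = (\<Sum>i=1..n. (w i)\<^sup>2) / real n - 2 * ((\<Sum>i=1..n. w i * fbar f n i) / real n) + (L2_norm f)\<^sup>2" for w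
  proof -
    \<comment> \<open>Cells are disjoint, so the square of a step function is the step function of
      the squares, and the adjoint formula against the constant 1 applies.\<close>
    have "(LINT x|lebesgue_on {0..<1}. (\<iota> n w x)\<^sup>2) = (LINT x|lebesgue_on {0..<1}. \<iota> n (\<lambda>i. (w i)\<^sup>2) x * 1)"
      by (intro Bochner_Integration.integral_cong) (simp_all add: \<iota>_eq[OF assms(1)])
    also have "\<dots> = (\<Sum>i=1..n. (w i)\<^sup>2) / real n"
      using integral_\<iota>_mult[OF assms(1) L2_bounded[of "\<lambda>_. 1" 1]] by (simp add: fbar_1[OF assms(1)])
    finally have sq: "(LINT x|lebesgue_on {0..<1}. (\<iota> n w x)\<^sup>2) = (\<Sum>i=1..n. (w i)\<^sup>2) / real n" .
    have ints: "integrable (lebesgue_on {0..<1}) (\<lambda>x. (\<iota> n w x)\<^sup>2)"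
      "integrable (lebesgue_on {0..<1}) (\<lambda>x. (f x)\<^sup>2)"
      "integrable (lebesgue_on {0..<1}) (\<lambda>x. \<iota> n w x * f x)"
      using \<iota>_L2[of n w] assms(2) L2_mult_integrable[OF \<iota>_L2 assms(2)] by (auto simp: L2_def)
    have "(L2_norm (\<lambda>x. \<iota> n w x - f x))\<^sup>2
       = (LINT x|lebesgue_on {0..<1}. (\<iota> n w x)\<^sup>2 - 2 * (\<iota> n w x * f x) + (f x)\<^sup>2)"
      unfolding L2_norm_power2 by (simp add: power2_diff algebra_simps)
    also have "\<dots> = (\<Sum>i=1..n. (w i)\<^sup>2) / real n - 2 * ((\<Sum>i=1..n. w i * fbar f n i) / real n) + (L2_norm f)\<^sup>2"
      using ints by (simp add: sq integral_\<iota>_mult[OF assms] L2_norm_power2)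
    finally show ?thesis .
  qed
  have "(\<Sum>i=1..n. (u i - fbar f n i)\<^sup>2)
      = (\<Sum>i=1..n. (u i)\<^sup>2) - 2 * (\<Sum>i=1..n. u i * fbar f n i) + (\<Sum>i=1..n. fbar f n i * fbar f n i)"
    unfolding sum_distrib_left sum_subtractf[symmetric] sum.distrib[symmetric]
    by (rule sum.cong) (auto simp: power2_eq_square algebra_simps)
  then show ?thesis
    unfolding expand by (simp add: diff_divide_distrib add_divide_distrib power2_eq_square)
qed

section \<open>Approximation by step functions with boundedly many jumps\<close>

text \<open>First \<open>f\<close> is truncated at a height \<open>m\<close>; then the truncation is
  approximated by continuous functions clamped at the same height. Both limits follow by dominated
  convergence, and 2 e/4 + 2 e/4 = e.\<close>

lemma L2_approx_continuous:
  assumes f: "f \<in> L2" and "0 < e"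
  obtains g where "continuous_on UNIV g" "g \<in> L2" "(L2_norm (\<lambda>x. g x - f x))\<^sup>2 \<le> e"
proof -
  let ?D = "lebesgue_on {0..<1::real}"
  interpret finite_measure ?D by (rule finite_measure_unit)
  define clamp :: "real \<Rightarrow> real \<Rightarrow> real" where "clamp c t = max (- c) (min c t)" for c t
  have clamp_cont: "continuous_on S (clamp c)" for c S
    unfolding clamp_def by (intro continuous_intros)
  have clamp_meas: "(\<lambda>x. clamp c (h x)) \<in> borel_measurable ?D" if "h \<in> borel_measurable ?D" for c h
    unfolding clamp_def using that by measurable
  have clamp_le: "\<bar>clamp c t\<bar> \<le> \<bar>c\<bar>" for c t by (auto simp: clamp_def)
  have fm: "f \<in> borel_measurable ?D" using f by (simp add: L2_def)

  have "(\<lambda>m. LINT x|?D. (clamp (real m) (f x) - f x)\<^sup>2) \<longlonglongrightarrow> (LINT x|?D. 0)"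
  proof (rule integral_dominated_convergence[where w = "\<lambda>x. (f x)\<^sup>2"])
    show "(\<lambda>x. (clamp (real m) (f x) - f x)\<^sup>2) \<in> borel_measurable ?D" for m
      using clamp_meas[OF fm] fm by measurable
    show "integrable ?D (\<lambda>x. (f x)\<^sup>2)" using f by (simp add: L2_def)
    have "norm ((clamp (real m) t - t)\<^sup>2) \<le> t\<^sup>2" for m t
    proof -
      have "\<bar>clamp (real m) t - t\<bar> \<le> \<bar>t\<bar>" by (auto simp: clamp_def max_def min_def)
      then show ?thesis by (simp add: abs_le_square_iff)
    qed
    then show "AE x in ?D. norm ((clamp (real m) (f x) - f x)\<^sup>2) \<le> (f x)\<^sup>2" for m
      by simp
    have "(\<lambda>m. (clamp (real m) t - t)\<^sup>2) \<longlonglongrightarrow> 0" for t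
    proof (rule tendsto_eventually)
      obtain k where "\<bar>t\<bar> \<le> real k" using real_arch_simple by blast
      then have "clamp (real m) t = t" if "k \<le> m" for m
        using that by (auto simp: clamp_def)
      then show "\<forall>\<^sub>F m in sequentially. (clamp (real m) t - t)\<^sup>2 = 0"
        by (auto intro!: eventually_sequentiallyI[of k])
    qed
    then show "AE x in ?D. (\<lambda>m. (clamp (real m) (f x) - f x)\<^sup>2) \<longlonglongrightarrow> 0"
      by simp
  qed simp
  then have "\<forall>\<^sub>F m in sequentially. (LINT x|?D. (clamp (real m) (f x) - f x)\<^sup>2) < e / 4"
    using \<open>0 < e\<close> by (intro order_tendstoD(2)) auto
  then obtain m where m: "(LINT x|?D. (clamp (real m) (f x) - f x)\<^sup>2) < e / 4"
    by (auto simp: eventually_sequentially)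

  \<comment> \<open>Unfolding \<open>measurable_on\<close> yields continuous functions converging to
    \<open>f\<close> off a negligible set.\<close>
  have "f measurable_on {0..<1}" using fm by (subst measurable_on_iff_borel_measurable) auto
  then obtain N g where N: "negligible N" and g: "\<And>n. continuous_on UNIV (g n)"
    and lim: "\<And>x. x \<notin> N \<Longrightarrow> (\<lambda>n. g n x) \<longlonglongrightarrow> (if x \<in> {0..<1} then f x else 0)"
    unfolding measurable_on_def by blast
  \<comment> \<open>The functions \<open>g n\<close> may be unbounded; clamping keeps continuity and
    supplies the constant majorant (2 m)^2 for the squared differences.\<close>
  define h where "h n x = clamp (real m) (g n x)" for n x
  have h_cont: "continuous_on UNIV (h n)" for n
    unfolding h_def using continuous_on_compose2[OF clamp_cont g] by auto
  have h_meas: "h n \<in> borel_measurable ?D" for n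
    by (intro measurable_restrict_space1 measurable_completion)
      (simp add: borel_measurable_continuous_onI h_cont)
  have h_L2: "h n \<in> L2" for n
    using clamp_le by (intro L2_bounded[OF h_meas]) (auto simp: h_def)
  have c_L2: "(\<lambda>x. clamp (real m) (f x)) \<in> L2"
    using clamp_le by (intro L2_bounded[OF clamp_meas[OF fm]])

  have "AE x in lebesgue. x \<notin> N"
    using N by (simp add: negligible_iff_null_sets AE_not_in)
  then have N': "AE x in ?D. x \<in> {0..<1} \<and> x \<notin> N"
    by (subst AE_restrict_space_iff) auto
  have "(\<lambda>n. LINT x|?D. (h n x - clamp (real m) (f x))\<^sup>2) \<longlonglongrightarrow> (LINT x|?D. 0)"
  proof (rule integral_dominated_convergence[where w = "\<lambda>x. (2 * real m)\<^sup>2"])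
    show "(\<lambda>x. (h n x - clamp (real m) (f x))\<^sup>2) \<in> borel_measurable ?D" for n
      using clamp_meas[OF fm] h_meas by measurable
    have "norm ((h n x - clamp (real m) t)\<^sup>2) \<le> (2 * real m)\<^sup>2" for n x t
    proof -
      have "\<bar>h n x - clamp (real m) t\<bar> \<le> \<bar>2 * real m\<bar>"
        using clamp_le[of "real m" "g n x"] clamp_le[of "real m" t] by (simp add: h_def)
      then show ?thesis by (simp only: abs_le_square_iff real_norm_def abs_power2)
    qed
    then show "AE x in ?D. norm ((h n x - clamp (real m) (f x))\<^sup>2) \<le> (2 * real m)\<^sup>2" for n
      by simp
    show "AE x in ?D. (\<lambda>n. (h n x - clamp (real m) (f x))\<^sup>2) \<longlonglongrightarrow> 0"
      using N'
    proof eventually_elim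
      case (elim x)
      then have "(\<lambda>n. g n x) \<longlonglongrightarrow> f x" using lim[of x] by simp
      then have "(\<lambda>n. h n x) \<longlonglongrightarrow> clamp (real m) (f x)"
        unfolding h_def clamp_def by (intro tendsto_intros)
      then have "(\<lambda>n. (h n x - clamp (real m) (f x))\<^sup>2) \<longlonglongrightarrow> (clamp (real m) (f x) - clamp (real m) (f x))\<^sup>2"
        by (intro tendsto_intros)
      then show ?case by simp
    qed
  qed simp_all
  then have "\<forall>\<^sub>F n in sequentially. (LINT x|?D. (h n x - clamp (real m) (f x))\<^sup>2) < e / 4"
    using \<open>0 < e\<close> by (intro order_tendstoD(2)) auto
  then obtain n where "(LINT x|?D. (h n x - clamp (real m) (f x))\<^sup>2) < e / 4"
    by (auto simp: eventually_sequentially)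
  then have "(L2_norm (\<lambda>x. h n x - f x))\<^sup>2 \<le> e"
    using L2_norm_power2_triangle[OF h_L2 c_L2 f, of n] m unfolding L2_norm_power2 by linarith
  then show ?thesis using that h_cont h_L2 by blast
qed

text \<open>The value on a cell of width 1/n is \<open>g\<close> at the left endpoint of the cell
  rounded down to the grid of mesh 1/k. The two roundings move a point by less than 1/n + 1/k \<le>
  2/k < d, with \<open>d\<close> from uniform continuity. A jump requires the grid point to change,
  which happens boundedly often.\<close>

lemma uniform_approx_\<iota>:
  fixes g :: "real \<Rightarrow> real"
  assumes "continuous_on {0..1} g" "0 < e"
  obtains k where "1 \<le> k" "\<And>n. k \<le> n \<Longrightarrow>
    \<exists>v. card (jumps n v) \<le> k + 1 \<and> (\<forall>x\<in>{0..<1}. \<bar>\<iota> n v x - g x\<bar> \<le> e)"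
proof -
  have "uniformly_continuous_on {0..1} g"
    using assms(1) by (intro compact_uniformly_continuous) auto
  then obtain d where "0 < d"
    and d: "\<And>x y. x \<in> {0..1} \<Longrightarrow> y \<in> {0..1} \<Longrightarrow> \<bar>y - x\<bar> < d \<Longrightarrow> \<bar>g y - g x\<bar> < e"
    using assms(2) unfolding uniformly_continuous_on_def dist_real_def by meson
  obtain k where k: "2 / d < real k" using reals_Archimedean2 by blast
  moreover have "0 < 2 / d" using \<open>0 < d\<close> by simp
  ultimately have "0 < real k" by linarith
  then have "1 \<le> k" and kd: "2 / real k < d" using k \<open>0 < d\<close> by (auto simp: field_simps)
  have "\<exists>v. card (jumps n v) \<le> k + 1 \<and> (\<forall>x\<in>{0..<1}. \<bar>\<iota> n v x - g x\<bar> \<le> e)" if "k \<le> n" for n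
  proof (intro exI conjI ballI)
    \<comment> \<open>sampling \<open>g\<close> on the grid of mesh \<open>1/k\<close> makes the number of jumps independent of \<open>n\<close>\<close>
    define q where "q i = k * i div n" for i
    \<comment> \<open>Cell \<open>i\<close> starts at (i - 1)/n, hence the shift by one.\<close>
    define v where "v i = g (real (q (i - 1)) / real k)" for i
    have "1 \<le> n" using \<open>1 \<le> k\<close> that by simp
    have q_mono: "q i \<le> q j" if "i \<le> j" for i j
      unfolding q_def by (intro div_le_mono mult_le_mono) (use that in auto)
    \<comment> \<open>A jump at \<open>j\<close> forces \<open>q\<close> to increase from
      \<open>j - 1\<close> to \<open>j\<close>. So \<open>q\<close> is injective on the jumps, and
      its values there lie in \<open>{0..k}\<close>.\<close>
    have "q i < q j" if "i < j" "j \<in> jumps n v" for i j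
    proof -
      have "v j \<noteq> v (j + 1)" using that by (simp add: jumps_def)
      then have "q (j - 1) \<noteq> q j" unfolding v_def by auto
      moreover have "q i \<le> q (j - 1)" "q (j - 1) \<le> q j" using that by (auto intro: q_mono)
      ultimately show ?thesis by linarith
    qed
    then have "inj_on q (jumps n v)"
      by (intro linorder_inj_onI) (auto simp: neq_iff)
    moreover have "q ` jumps n v \<subseteq> {0..k}"
    proof -
      have "q i \<le> k" if "i \<in> jumps n v" for i
      proof -
        have "q i \<le> q n" using that by (intro q_mono) (auto simp: jumps_def)
        then show ?thesis using \<open>1 \<le> n\<close> by (simp add: q_def)
      qed
      then show ?thesis by auto
    qed
    ultimately have "card (jumps n v) \<le> card {0..k}" by (intro card_inj_on_le) auto
    then show "card (jumps n v) \<le> k + 1" by simp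
    fix x :: real assume x: "x \<in> {0..<1}"
    define l where "l = nat \<lfloor>real n * x\<rfloor>"
    have l: "real l \<le> real n * x" "real n * x < real l + 1"
      using x by (auto simp: l_def of_nat_nat)
    have "real n * real (q l) \<le> real k * real l"
      unfolding q_def of_nat_mult[symmetric] of_nat_le_iff by simp
    also have "\<dots> \<le> real k * (real n * x)" using l by (intro mult_left_mono) auto
    finally have "real n * real (q l) \<le> real n * (real k * x)" by (simp add: mult_ac)
    then have q1: "real (q l) / real k \<le> x"
      using \<open>1 \<le> n\<close> \<open>1 \<le> k\<close> by (simp add: field_simps)
    have "k * l < n * (q l + 1)"
      using \<open>1 \<le> n\<close> dividend_less_times_div[of n "k * l"] by (simp add: q_def)
    then have "real (k * l) < real (n * (q l + 1))" by (simp only: of_nat_less_iff)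
    then have "real k * real l < real n * (real (q l) + 1)"
      by (simp only: of_nat_mult of_nat_add of_nat_1)
    moreover have "real k * (real n * x) \<le> real k * (real l + 1)" using l by (intro mult_left_mono) auto
    moreover have "real k \<le> real n" using that by simp
    ultimately have "real n * (real k * x) < real n * (real (q l) + 2)"
      by (simp add: algebra_simps)
    then have "real k * x < real (q l) + 2"
      by (rule mult_left_less_imp_less) simp
    then have "x < (real (q l) + 2) / real k"
      using \<open>1 \<le> k\<close> by (simp add: field_simps)
    then have q2: "x - real (q l) / real k < d" using kd by (simp add: add_divide_distrib)
    have "\<bar>g (real (q l) / real k) - g x\<bar> < e"
      using q1 q2 x \<open>0 < d\<close> by (intro d) auto
    then show "\<bar>\<iota> n v x - g x\<bar> \<le> e"
      using \<iota>_eq[OF \<open>1 \<le> n\<close> x, of v] by (simp add: v_def l_def)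
  qed
  then show ?thesis using that \<open>1 \<le> k\<close> by blast
qed

text \<open>Since the unit interval has measure 1, a uniform error of \<open>sqrt (e / 4)\<close>
  costs at most \<open>e / 4\<close> in the squared norm; the continuous approximation costs another
  \<open>e / 4\<close>.\<close>

lemma L2_approx_\<iota>:
  assumes f: "f \<in> L2" and "0 < e"
  obtains k where "1 \<le> k" "\<And>n. k \<le> n \<Longrightarrow>
    \<exists>v. card (jumps n v) \<le> k + 1 \<and> (L2_norm (\<lambda>x. \<iota> n v x - f x))\<^sup>2 \<le> e"
proof -
  obtain g where g: "continuous_on UNIV g" "g \<in> L2" "(L2_norm (\<lambda>x. g x - f x))\<^sup>2 \<le> e / 4"
    using L2_approx_continuous[OF f, of "e / 4"] \<open>0 < e\<close> by auto
  have "continuous_on {0..1} g" using g(1) continuous_on_subset by blast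
  then obtain k where "1 \<le> k" and k: "\<And>n. k \<le> n \<Longrightarrow>
    \<exists>v. card (jumps n v) \<le> k + 1 \<and> (\<forall>x\<in>{0..<1}. \<bar>\<iota> n v x - g x\<bar> \<le> sqrt (e / 4))"
    using uniform_approx_\<iota>[of g "sqrt (e / 4)"] \<open>0 < e\<close> by auto
  have "\<exists>v. card (jumps n v) \<le> k + 1 \<and> (L2_norm (\<lambda>x. \<iota> n v x - f x))\<^sup>2 \<le> e" if kn: "k \<le> n" for n
  proof -
    obtain v where v: "card (jumps n v) \<le> k + 1"
      and close: "\<And>x. x \<in> {0..<1} \<Longrightarrow> \<bar>\<iota> n v x - g x\<bar> \<le> sqrt (e / 4)"
      using k[OF kn] by blast
    have le: "(\<iota> n v x - g x)\<^sup>2 \<le> e / 4" if "x \<in> {0..<1}" for x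
    proof -
      have "\<bar>\<iota> n v x - g x\<bar>\<^sup>2 \<le> (sqrt (e / 4))\<^sup>2"
        using close[OF that] by (intro power_mono) auto
      then show ?thesis using \<open>0 < e\<close> by simp
    qed
    interpret finite_measure "lebesgue_on {0..<1::real}" by (rule finite_measure_unit)
    have "(L2_norm (\<lambda>x. \<iota> n v x - g x))\<^sup>2 \<le> (LINT x|lebesgue_on {0..<1::real}. e / 4)"
      unfolding L2_norm_power2
    proof (rule integral_mono)
      show "integrable (lebesgue_on {0..<1}) (\<lambda>x. (\<iota> n v x - g x)\<^sup>2)"
        using L2_diff[OF \<iota>_L2 g(2), of n v] by (simp add: L2_def)
    qed (use le in auto)
    also have "\<dots> = e / 4"
      by (simp add: measure_restrict_space)
    finally have "(L2_norm (\<lambda>x. \<iota> n v x - f x))\<^sup>2 \<le> e"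
      using L2_norm_power2_triangle[OF \<iota>_L2 g(2) f, of n v] g(3) by simp
    then show ?thesis using v by blast
  qed
  then show ?thesis using that \<open>1 \<le> k\<close> by blast
qed

section \<open>From Condition (A) to almost sure convergence\<close>

lemma partial_sums_le_of_Max:
  fixes \<xi> :: "nat \<Rightarrow> real"
  assumes "Max {(\<Sum>k=i..j. \<xi> k)\<^sup>2 / real (j - i + 1) | i j. 1 \<le> i \<and> i \<le> j \<and> j \<le> n} \<le> b"
    and "1 \<le> i" "i \<le> j" "j \<le> n"
  shows "(\<Sum>k=i..j. \<xi> k)\<^sup>2 \<le> b * real (j - i + 1)"
proof -
  let ?A = "{(\<Sum>k=i..j. \<xi> k)\<^sup>2 / real (j - i + 1) | i j. 1 \<le> i \<and> i \<le> j \<and> j \<le> n}"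
  \<comment> \<open>\<open>Max\<close> bounds the elements of a set only if the set is
    finite.\<close>
  have "?A \<subseteq> (\<lambda>(i, j). (\<Sum>k=i..j. \<xi> k)\<^sup>2 / real (j - i + 1)) ` ({..n} \<times> {..n})"
  proof
    fix t assume "t \<in> ?A"
    then obtain i j where "t = (\<Sum>k=i..j. \<xi> k)\<^sup>2 / real (j - i + 1)" "i \<le> j" "j \<le> n" by blast
    then show "t \<in> (\<lambda>(i, j). (\<Sum>k=i..j. \<xi> k)\<^sup>2 / real (j - i + 1)) ` ({..n} \<times> {..n})"
      by (intro image_eqI[of _ _ "(i, j)"]) auto
  qed
  then have "finite ?A" by (rule finite_subset) simp
  then have "(\<Sum>k=i..j. \<xi> k)\<^sup>2 / real (j - i + 1) \<le> Max ?A"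
    using assms(2-4) by (intro Max_ge) blast+
  also note assms(1)
  finally show ?thesis by (simp add: pos_divide_le_eq)
qed

text \<open>The deterministic core, for a single outcome: \<open>K\<close> is chosen from
  \<open>f\<close> and \<open>e\<close> alone, so the penalty of the competitors vanishes with
  \<open>g n\<close>.\<close>

lemma tendsto_L2_minimizers:
  assumes f: "f \<in> L2" and b: "\<And>n. 1 \<le> n \<Longrightarrow> 0 < b n"
    and noise: "\<forall>\<^sub>F n in sequentially. \<forall>i j. 1 \<le> i \<longrightarrow> i \<le> j \<longrightarrow> j \<le> n \<longrightarrow>
        (\<Sum>k=i..j. \<xi> n k)\<^sup>2 \<le> b n * real (j - i + 1)"
    and y: "\<And>n i. i \<in> {1..n} \<Longrightarrow> y n i = fbar f n i + \<xi> n i"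
    and g0: "g \<longlonglongrightarrow> 0" and gb: "filterlim (\<lambda>n. g n * real n / b n) at_top sequentially"
    and F: "\<And>n. 1 \<le> n \<Longrightarrow> F n \<in> \<iota> n ` argmin_H n (g n) (y n)"
  shows "tendsto_L2 F f"
  unfolding tendsto_L2_def
proof (intro conjI allI impI f)
  show "F n \<in> L2" if "1 \<le> n" for n using F[OF that] \<iota>_L2 by auto
  have "(\<lambda>n. (L2_norm (\<lambda>x. F n x - f x))\<^sup>2) \<longlonglongrightarrow> 0"
  proof (rule order_tendstoI)
    fix a :: real assume "a < 0"
    then show "\<forall>\<^sub>F n in sequentially. a < (L2_norm (\<lambda>x. F n x - f x))\<^sup>2"
      by (intro always_eventually) (auto intro: less_le_trans)
  next
    fix e :: real assume "0 < e"
    \<comment> \<open>The comparison triples the error of the competitor, so \<open>e / 6\<close>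
      contributes \<open>e / 2\<close>; the other half is left for the penalty.\<close>
    then obtain K where "1 \<le> K" and K: "\<And>n. K \<le> n \<Longrightarrow>
        \<exists>v. card (jumps n v) \<le> K + 1 \<and> (L2_norm (\<lambda>x. \<iota> n v x - f x))\<^sup>2 \<le> e / 6"
      using L2_approx_\<iota>[OF f, of "e / 6"] by auto
    define C where "C = 2 * (2 * (real K + 1) + 1)"
    have "0 < C" by (simp add: C_def)
    have "\<forall>\<^sub>F n in sequentially. g n < e / (2 * C)"
      using g0 \<open>0 < e\<close> \<open>0 < C\<close> by (intro order_tendstoD(2)) auto
    moreover have "\<forall>\<^sub>F n in sequentially. 4 \<le> g n * real n / b n"
      using gb by (simp add: filterlim_at_top)
    ultimately show "\<forall>\<^sub>F n in sequentially. (L2_norm (\<lambda>x. F n x - f x))\<^sup>2 < e"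
      using noise eventually_ge_at_top[of K]
    proof eventually_elim
      case (elim n)
      have "1 \<le> n" using elim(4) \<open>1 \<le> K\<close> by simp
      have "0 < b n" using b \<open>1 \<le> n\<close> by simp
      then have small: "4 * b n \<le> g n * real n" using elim(2) by (simp add: field_simps)
      then have "0 < g n * real n" using \<open>0 < b n\<close> by linarith
      then have "0 \<le> g n" by (simp add: zero_less_mult_iff)
      obtain u where u: "u \<in> argmin_H n (g n) (y n)" "F n = \<iota> n u" using F[OF \<open>1 \<le> n\<close>] by auto
      obtain v where v: "card (jumps n v) \<le> K + 1" "(L2_norm (\<lambda>x. \<iota> n v x - f x))\<^sup>2 \<le> e / 6"
        using K[OF elim(4)] by auto
      have "(\<Sum>i=1..n. (u i - fbar f n i)\<^sup>2) / real n
          \<le> 2 * g n * (2 * real (card (jumps n v)) + 1) + 3 * ((\<Sum>i=1..n. (v i - fbar f n i)\<^sup>2) / real n)"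
        using elim(3) \<open>0 < b n\<close> \<open>1 \<le> n\<close> small y u(1) by (intro minimizer_error_le[where b = "b n" and \<xi> = "\<xi> n"]) auto
      moreover have "2 * g n * (2 * real (card (jumps n v)) + 1) \<le> 2 * g n * (2 * (real K + 1) + 1)"
        using v(1) \<open>0 \<le> g n\<close> by (intro mult_left_mono) auto
      moreover have "2 * g n * (2 * (real K + 1) + 1) < e / 2"
        using elim(1) \<open>0 < C\<close> by (simp add: C_def field_simps)
      ultimately have "(\<Sum>i=1..n. (u i - fbar f n i)\<^sup>2) / real n
          < e / 2 + 3 * ((\<Sum>i=1..n. (v i - fbar f n i)\<^sup>2) / real n)"
        by linarith
      \<comment> \<open>The residual enters once on the side of \<open>u\<close> but can be counted
        three times on the side of \<open>v\<close>, because it is nonnegative.\<close>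
      moreover have "0 \<le> (L2_norm (\<lambda>x. \<iota> n (fbar f n) x - f x))\<^sup>2" by simp
      ultimately show ?case
        using L2_norm_\<iota>_diff[OF \<open>1 \<le> n\<close> f, of u] L2_norm_\<iota>_diff[OF \<open>1 \<le> n\<close> f, of v] v(2)
        unfolding u(2) by linarith
    qed
  qed
  then have "(\<lambda>n. sqrt ((L2_norm (\<lambda>x. F n x - f x))\<^sup>2)) \<longlonglongrightarrow> sqrt 0"
    by (rule tendsto_real_sqrt)
  then show "(\<lambda>n. L2_norm (\<lambda>x. F n x - f x)) \<longlonglongrightarrow> 0"
    by (simp add: L2_norm_def)
qed

theorem theorem2:
  fixes M :: "'a measure"
    and \<xi> :: "nat \<Rightarrow> nat \<Rightarrow> 'a \<Rightarrow> real"
    and \<beta> :: "nat \<Rightarrow> real"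
    and f :: "real \<Rightarrow> real"
    and \<gamma> :: "nat \<Rightarrow> 'a \<Rightarrow> real"
    and fhat :: "nat \<Rightarrow> 'a \<Rightarrow> real \<Rightarrow> real"
  assumes "prob_space M"
    and "zero_mean_array M \<xi>"
    and "condition_A M \<xi> \<beta>"
    and "f \<in> L2"
    and "\<And>n. n \<ge> 1 \<Longrightarrow> \<gamma> n \<in> borel_measurable M"
    and "\<And>n \<omega>. n \<ge> 1 \<Longrightarrow> \<omega> \<in> space M \<Longrightarrow> \<gamma> n \<omega> > 0"
    and "AE \<omega> in M. (\<lambda>n. \<gamma> n \<omega>) \<longlonglongrightarrow> 0"
    and "AE \<omega> in M. filterlim (\<lambda>n. \<gamma> n \<omega> * real n / \<beta> n) at_top sequentially"
    and "\<And>n \<omega>. n \<ge> 1 \<Longrightarrow> \<omega> \<in> space M \<Longrightarrow>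
           fhat n \<omega> \<in> \<iota> n ` argmin_H n (\<gamma> n \<omega>) (Y f \<xi> n \<omega>)"
  shows "AE \<omega> in M. tendsto_L2 (\<lambda>n. fhat n \<omega>) f"
proof -
  have \<beta>: "\<And>n. 1 \<le> n \<Longrightarrow> 0 < \<beta> n"
    and "AE \<omega> in M. \<forall>\<^sub>F n in sequentially.
        Max {(\<Sum>k=i..j. \<xi> n k \<omega>)\<^sup>2 / real (j - i + 1) | i j. 1 \<le> i \<and> i \<le> j \<and> j \<le> n} \<le> \<beta> n"
    using assms(3) by (auto simp: condition_A_def)
  \<comment> \<open>The almost sure conditions hold together off a null set, and each remaining
    outcome is treated deterministically. \<open>AE_space\<close> makes the positivity and minimizer
    hypotheses, stated on \<open>space M\<close>, available there.\<close>
  from this(2) assms(7,8) AE_space show ?thesis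
  proof eventually_elim
    case (elim \<omega>)
    have "\<forall>\<^sub>F n in sequentially. \<forall>i j. 1 \<le> i \<longrightarrow> i \<le> j \<longrightarrow> j \<le> n \<longrightarrow>
        (\<Sum>k=i..j. \<xi> n k \<omega>)\<^sup>2 \<le> \<beta> n * real (j - i + 1)"
      using elim(1) by eventually_elim (blast intro: partial_sums_le_of_Max)
    then show ?case
      using elim(2-4) \<beta> assms(4,9)
      by (intro tendsto_L2_minimizers[where b = \<beta> and g = "\<lambda>n. \<gamma> n \<omega>" and y = "\<lambda>n. Y f \<xi> n \<omega>"
            and \<xi> = "\<lambda>n k. \<xi> n k \<omega>"]) (auto simp: Y_def)
  qed
qed

end
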